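(* Let $p\in[1,\infty]$, and let $E=\{E_a\}_{a=1}^{n_E}$ and $F=\{F_b\}_{b=1}^{n_F}$ be measurements acting on $\mathbb{C}^{d_1}$. (i) (Trivial extension) Let $E'_a:=E_a\otimes\mathbb{1}_{d_2}$ and $F'_b:=F_b\otimes\mathbb{1}_{d_2}$, where $\mathbb{1}_{d_2}$ is the identity on $\mathbb{C}^{d_2}$. Then $\Upsilon_p(E',F')=d_2^{\frac1p}\,\Upsilon_p(E,F)$. (ii) (Direct sum composition) Let $\bar E=\{\bar E_a\}_{a=1}^{n_{\bar E}}$ and $\bar F=\{\bar F_b\}_{b=1}^{n_{\bar F}}$ be measurements acting on $\mathbb{C}^{d_2}$. Let $E'$ be the measurement on $\mathbb{C}^{d_1}\oplus\mathbb{C}^{d_2}$ with $n_E+n_{\bar E}$ outcomes given by $E'_a=E_a\oplus 0$ for $a\le n_E$ and $E'_a=0\oplus\bar E_{a-n_E}$ for $a>n_E$, and let $F'$ be the measurement with $n_F+n_{\bar F}$ outcomes given by $F'_b=F_b\oplus 0$ for $b\le n_F$ and $F'_b=0\oplus\bar F_{b-n_F}$ for $b>n_F$. Then $\Upsilon_p(E',F')=\Upsilon_p(E,F)+\Upsilon_p(\bar E,\bar F)$.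
   Context: A measurement with $n$ outcomes acting on a finite-dimensional complex Hilbert space is a family $\{E_a\}_{a=1}^n$ of non-zero positive semi-definite operators on it with $\sum_a E_a=\mathbb{1}$. The Schatten $p$-norm $\|A\|_p$ is the $\ell_p$-norm of the vector of singular values of $A$ (the largest singular value for $p=\infty$). Define $\Upsilon_p(E,F):=\sum_{a,b}\|[E_a,F_b]\|_p$, where $[A,B]=AB-BA$ and the sum runs over all outcomes. Convention: $d_2^{1/p}=1$ for $p=\infty$. *)

theory Defs
  imports
    "Jordan_Normal_Form.Schur_Decomposition"
    "HOL-Library.Extended_Real"
begin

text \<open>The order on \<^typ>\<open>complex\<close> is the one of \<^theory>\<open>HOL-Library.Complex_Order\<close>: \<open>0 \<le> z\<close> says that
  \<open>z\<close> is real and non-negative.\<close>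

definition psd_mat :: "nat \<Rightarrow> complex mat \<Rightarrow> bool" where
  "psd_mat d A \<longleftrightarrow> A \<in> carrier_mat d d \<and> (\<forall>v \<in> carrier_vec d. 0 \<le> (A *\<^sub>v v) \<bullet>c v)"

text \<open>Outcomes are numbered from \<open>1\<close> to \<open>n\<close>. The sum of the operators is written entrywise because
  \<^typ>\<open>complex mat\<close> has no zero independent of the dimension.\<close>

definition measurement :: "nat \<Rightarrow> nat \<Rightarrow> (nat \<Rightarrow> complex mat) \<Rightarrow> bool" where
  "measurement d n E \<longleftrightarrow>
     (\<forall>a \<in> {1..n}. psd_mat d (E a) \<and> E a \<noteq> 0\<^sub>m d d) \<and>
     mat d d (\<lambda>(i, j). \<Sum>a\<in>{1..n}. E a $$ (i, j)) = 1\<^sub>m d"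

text \<open>The singular values of \<open>A\<close>, with multiplicity: the square roots of the eigenvalues of \<open>A\<^sup>* A\<close>,
  which are real and non-negative.\<close>

definition singular_values :: "complex mat \<Rightarrow> real multiset" where
  "singular_values A =
     image_mset (\<lambda>x. sqrt (Re x)) (proots (char_poly (mat_adjoint A * A)))"

definition schatten_norm :: "ereal \<Rightarrow> complex mat \<Rightarrow> real" where
  "schatten_norm p A =
     (if p = \<infinity> then Max (set_mset (singular_values A))
      else (\<Sum>s\<in>#singular_values A. s powr real_of_ereal p) powr (1 / real_of_ereal p))"

definition commutator :: "complex mat \<Rightarrow> complex mat \<Rightarrow> complex mat" where
  "commutator A B = A * B - B * A"

definition Upsilon ::
    "ereal \<Rightarrow> nat \<Rightarrow> (nat \<Rightarrow> complex mat) \<Rightarrow> nat \<Rightarrow> (nat \<Rightarrow> complex mat) \<Rightarrow> real" where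
  "Upsilon p nE E nF F =
     (\<Sum>a\<in>{1..nE}. \<Sum>b\<in>{1..nF}. schatten_norm p (commutator (E a) (F b)))"

text \<open>The Kronecker product: the basis vector \<open>e\<^sub>i \<otimes> e\<^sub>k\<close> has index \<open>i * d\<^sub>2 + k\<close>.\<close>

definition tensor_mat :: "complex mat \<Rightarrow> complex mat \<Rightarrow> complex mat" where
  "tensor_mat A B =
     mat (dim_row A * dim_row B) (dim_col A * dim_col B)
       (\<lambda>(i, j). A $$ (i div dim_row B, j div dim_col B) * B $$ (i mod dim_row B, j mod dim_col B))"

definition direct_sum_mat :: "complex mat \<Rightarrow> complex mat \<Rightarrow> complex mat" where
  "direct_sum_mat A B =
     four_block_mat A (0\<^sub>m (dim_row A) (dim_col B)) (0\<^sub>m (dim_row B) (dim_col A)) B"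

text \<open>The family \<open>E\<^sub>1 \<oplus> 0, \<dots>, E\<^sub>n \<oplus> 0, 0 \<oplus> G\<^sub>1, 0 \<oplus> G\<^sub>2, \<dots>\<close>, where \<open>E\<close> has \<open>n\<close> members and acts in
  dimension \<open>d\<^sub>1\<close>, and \<open>G\<close> acts in dimension \<open>d\<^sub>2\<close>.\<close>

definition direct_sum_family ::
    "nat \<Rightarrow> nat \<Rightarrow> nat \<Rightarrow> (nat \<Rightarrow> complex mat) \<Rightarrow> (nat \<Rightarrow> complex mat) \<Rightarrow> nat \<Rightarrow> complex mat" where
  "direct_sum_family d1 d2 n E G a =
     (if a \<le> n then direct_sum_mat (E a) (0\<^sub>m d2 d2)
      else direct_sum_mat (0\<^sub>m d1 d1) (G (a - n)))"

lemma sum_lessThan_mult: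
  fixes f :: "nat \<Rightarrow> complex"
  shows "(\<Sum>l<m * k. f l) = (\<Sum>i<m. \<Sum>r<k. f (i * k + r))"
proof -
  have "sum f {i * k..<i * k + k} = (\<Sum>r<k. f (i * k + r))" for i
    using sum.shift_bounds_nat_ivl[of f 0 "i * k" k]
    by (simp add: add.commute atLeast0LessThan)
  then show ?thesis
    by (simp add: sum.nat_group[symmetric])
qed

lemma psd_mat_alt:
  "psd_mat d A \<longleftrightarrow> A \<in> carrier_mat d d \<and>
     (\<forall>f. 0 \<le> (\<Sum>i<d. (\<Sum>j<d. A $$ (i, j) * f j) * cnj (f i)))"
proof -
  have eq: "(A *\<^sub>v v) \<bullet>c v = (\<Sum>i<d. (\<Sum>j<d. A $$ (i, j) * v $ j) * cnj (v $ i))"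
    if "A \<in> carrier_mat d d" "v \<in> carrier_vec d" for v
    using that by (auto simp: scalar_prod_def atLeast0LessThan intro!: sum.cong)
  have "(\<forall>v \<in> carrier_vec d. 0 \<le> (A *\<^sub>v v) \<bullet>c v) \<longleftrightarrow>
      (\<forall>f. 0 \<le> (\<Sum>i<d. (\<Sum>j<d. A $$ (i, j) * f j) * cnj (f i)))"
    if A: "A \<in> carrier_mat d d"
  proof (intro iffI allI ballI)
    fix f assume "\<forall>v \<in> carrier_vec d. 0 \<le> (A *\<^sub>v v) \<bullet>c v"
    then have "0 \<le> (A *\<^sub>v vec d f) \<bullet>c vec d f" by simp
    then show "0 \<le> (\<Sum>i<d. (\<Sum>j<d. A $$ (i, j) * f j) * cnj (f i))"
      by (subst (asm) eq[OF A]) auto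
  next
    fix v :: "complex vec" assume v: "v \<in> carrier_vec d"
      and "\<forall>f. 0 \<le> (\<Sum>i<d. (\<Sum>j<d. A $$ (i, j) * f j) * cnj (f i))"
    then show "0 \<le> (A *\<^sub>v v) \<bullet>c v" by (simp only: eq[OF A v])
  qed
  then show ?thesis unfolding psd_mat_def by blast
qed

lemma measurement_tensor_one:
  assumes "0 < d2" and E: "measurement d1 n E"
  shows "measurement (d1 * d2) n (\<lambda>a. tensor_mat (E a) (1\<^sub>m d2))"
proof -
  have dm: "i * d2 + r < d1 * d2" if "i < d1" "r < d2" for i r
  proof -
    have "i * d2 + r < Suc i * d2" using that by simp
    also have "\<dots> \<le> d1 * d2" using that by (intro mult_right_mono) auto
    finally show ?thesis .
  qed
  have lt: "i div d2 < d1" if "i < d1 * d2" for i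
    using that by (simp add: less_mult_imp_div_less)
  have c: "E a \<in> carrier_mat d1 d1" if "a \<in> {1..n}" for a
    using E that by (auto simp: measurement_def psd_mat_def)
  have ix: "tensor_mat (E a) (1\<^sub>m d2) $$ (i, j) =
      E a $$ (i div d2, j div d2) * (if i mod d2 = j mod d2 then 1 else 0)"
    if "a \<in> {1..n}" "i < d1 * d2" "j < d1 * d2" for a i j
    using c[OF that(1)] that \<open>0 < d2\<close> by (auto simp: tensor_mat_def)
  have "psd_mat (d1 * d2) (tensor_mat (E a) (1\<^sub>m d2))" if a: "a \<in> {1..n}" for a
    unfolding psd_mat_alt
  proof (intro conjI allI)
    show "tensor_mat (E a) (1\<^sub>m d2) \<in> carrier_mat (d1 * d2) (d1 * d2)"
      using c[OF a] by (auto simp: tensor_mat_def)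
    fix f :: "nat \<Rightarrow> complex"
    have "(\<Sum>l<d1 * d2. (\<Sum>m<d1 * d2. tensor_mat (E a) (1\<^sub>m d2) $$ (l, m) * f m) * cnj (f l)) =
        (\<Sum>i<d1. \<Sum>r<d2. (\<Sum>j<d1. E a $$ (i, j) * f (j * d2 + r)) * cnj (f (i * d2 + r)))"
      unfolding sum_lessThan_mult
    proof (intro sum.cong refl arg_cong2[where f = "(*)"])
      fix i r j assume i: "i \<in> {..<d1}" "r \<in> {..<d2}" "j \<in> {..<d1}"
      have "(\<Sum>s<d2. tensor_mat (E a) (1\<^sub>m d2) $$ (i * d2 + r, j * d2 + s) * f (j * d2 + s)) =
        (\<Sum>s<d2. if r = s then E a $$ (i, j) * f (j * d2 + s) else 0)"
        using i by (intro sum.cong refl) (auto simp: ix[OF a] dm)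
      also have "\<dots> = E a $$ (i, j) * f (j * d2 + r)"
        using i by simp
      finally show "(\<Sum>s<d2. tensor_mat (E a) (1\<^sub>m d2) $$ (i * d2 + r, j * d2 + s) * f (j * d2 + s)) =
        E a $$ (i, j) * f (j * d2 + r)" .
    qed
    also have "\<dots> = (\<Sum>r<d2. \<Sum>i<d1. (\<Sum>j<d1. E a $$ (i, j) * f (j * d2 + r)) * cnj (f (i * d2 + r)))"
      by (rule sum.swap)
    also have "\<dots> \<ge> 0"
    proof (rule sum_nonneg)
      fix r
      show "0 \<le> (\<Sum>i<d1. (\<Sum>j<d1. E a $$ (i, j) * f (j * d2 + r)) * cnj (f (i * d2 + r)))"
        using E a psd_mat_alt[of d1 "E a"] unfolding measurement_def
        by (auto dest!: spec[of _ "\<lambda>j. f (j * d2 + r)"])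
    qed
    finally show "0 \<le> (\<Sum>l<d1 * d2. (\<Sum>m<d1 * d2. tensor_mat (E a) (1\<^sub>m d2) $$ (l, m) * f m) * cnj (f l))" .
  qed
  moreover have "tensor_mat (E a) (1\<^sub>m d2) \<noteq> 0\<^sub>m (d1 * d2) (d1 * d2)" if a: "a \<in> {1..n}" for a
  proof
    assume z: "tensor_mat (E a) (1\<^sub>m d2) = 0\<^sub>m (d1 * d2) (d1 * d2)"
    have "E a = 0\<^sub>m d1 d1"
    proof (rule eq_matI)
      fix i j assume "i < dim_row (0\<^sub>m d1 d1 :: complex mat)" "j < dim_col (0\<^sub>m d1 d1 :: complex mat)"
      then show "E a $$ (i, j) = 0\<^sub>m d1 d1 $$ (i, j)"
        using ix[OF a, of "i * d2" "j * d2"] dm[of i 0] dm[of j 0] z \<open>0 < d2\<close> by simp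
    qed (use c[OF a] in auto)
    with E a show False by (auto simp: measurement_def)
  qed
  moreover have "mat (d1 * d2) (d1 * d2) (\<lambda>(i, j). \<Sum>a\<in>{1..n}. tensor_mat (E a) (1\<^sub>m d2) $$ (i, j))
      = 1\<^sub>m (d1 * d2)"
  proof (rule eq_matI)
    fix i j assume "i < dim_row (1\<^sub>m (d1 * d2) :: complex mat)" "j < dim_col (1\<^sub>m (d1 * d2) :: complex mat)"
    then have ij: "i < d1 * d2" "j < d1 * d2" by auto
    have "(\<Sum>a\<in>{1..n}. tensor_mat (E a) (1\<^sub>m d2) $$ (i, j)) =
        (\<Sum>a\<in>{1..n}. E a $$ (i div d2, j div d2)) * (if i mod d2 = j mod d2 then 1 else 0)"
      unfolding sum_distrib_right using ij by (intro sum.cong refl ix)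
    also have "(\<Sum>a\<in>{1..n}. E a $$ (i div d2, j div d2)) =
        mat d1 d1 (\<lambda>(i, j). \<Sum>a\<in>{1..n}. E a $$ (i, j)) $$ (i div d2, j div d2)"
      using ij lt by simp
    also have "\<dots> = 1\<^sub>m d1 $$ (i div d2, j div d2)"
      using E by (simp add: measurement_def)
    also have "\<dots> = (if i div d2 = j div d2 then 1 else 0)"
      using ij lt by simp
    also have "\<dots> * (if i mod d2 = j mod d2 then 1 else 0) = (if i = j then 1 else (0 :: complex))"
    proof -
      have "i = j" if "i div d2 = j div d2" "i mod d2 = j mod d2"
        using that by (metis div_mult_mod_eq)
      then show ?thesis by auto
    qed
    finally show "mat (d1 * d2) (d1 * d2) (\<lambda>(i, j). \<Sum>a\<in>{1..n}. tensor_mat (E a) (1\<^sub>m d2) $$ (i, j)) $$ (i, j)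
      = 1\<^sub>m (d1 * d2) $$ (i, j)" using ij by simp
  qed auto
  ultimately show ?thesis unfolding measurement_def by blast
qed

lemma psd_mat_zero: "psd_mat d (0\<^sub>m d d)"
  unfolding psd_mat_alt by auto

lemma sum_lessThan_add:
  fixes f :: "nat \<Rightarrow> complex"
  shows "(\<Sum>l<m + k. f l) = (\<Sum>i<m. f i) + (\<Sum>i<k. f (m + i))"
  by (induction k) (auto simp: add.assoc)

lemma psd_mat_direct_sum:
  assumes "psd_mat d1 A" "psd_mat d2 B"
  shows "psd_mat (d1 + d2) (direct_sum_mat A B)"
  unfolding psd_mat_alt
proof (intro conjI allI)
  have c: "A \<in> carrier_mat d1 d1" "B \<in> carrier_mat d2 d2"
    using assms by (auto simp: psd_mat_def)
  then show "direct_sum_mat A B \<in> carrier_mat (d1 + d2) (d1 + d2)"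
    by (simp add: direct_sum_mat_def)
  fix f :: "nat \<Rightarrow> complex"
  have "(\<Sum>i<d1 + d2. (\<Sum>j<d1 + d2. direct_sum_mat A B $$ (i, j) * f j) * cnj (f i)) =
      (\<Sum>i<d1. (\<Sum>j<d1. A $$ (i, j) * f j) * cnj (f i)) +
      (\<Sum>i<d2. (\<Sum>j<d2. B $$ (i, j) * f (d1 + j)) * cnj (f (d1 + i)))"
    unfolding sum_lessThan_add using c by (auto simp: direct_sum_mat_def)
  also have "0 \<le> \<dots>"
    using assms by (intro add_nonneg_nonneg) (auto simp: psd_mat_alt)
  finally show "0 \<le> (\<Sum>i<d1 + d2. (\<Sum>j<d1 + d2. direct_sum_mat A B $$ (i, j) * f j) * cnj (f i))" .
qed

lemma direct_sum_mat_eq_zero_iff: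
  assumes "A \<in> carrier_mat d1 d1" "B \<in> carrier_mat d2 d2"
  shows "direct_sum_mat A B = 0\<^sub>m (d1 + d2) (d1 + d2) \<longleftrightarrow> A = 0\<^sub>m d1 d1 \<and> B = 0\<^sub>m d2 d2"
proof (intro iffI conjI)
  assume z: "direct_sum_mat A B = 0\<^sub>m (d1 + d2) (d1 + d2)"
  have "A $$ (i, j) = 0" if "i < d1" "j < d1" for i j
    using arg_cong[OF z, of "\<lambda>M. M $$ (i, j)"] that assms by (simp add: direct_sum_mat_def)
  then show "A = 0\<^sub>m d1 d1" using assms by (intro eq_matI) auto
  have "B $$ (i, j) = 0" if "i < d2" "j < d2" for i j
    using arg_cong[OF z, of "\<lambda>M. M $$ (d1 + i, d1 + j)"] that assms by (simp add: direct_sum_mat_def)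
  then show "B = 0\<^sub>m d2 d2" using assms by (intro eq_matI) auto
qed (simp add: direct_sum_mat_def)

lemma measurement_direct_sum:
  assumes E: "measurement d1 n E" and G: "measurement d2 m G"
  shows "measurement (d1 + d2) (n + m) (direct_sum_family d1 d2 n E G)"
proof -
  let ?D = "direct_sum_family d1 d2 n E G"
  have pE: "psd_mat d1 (E a)" "E a \<in> carrier_mat d1 d1" "E a \<noteq> 0\<^sub>m d1 d1" if "a \<in> {1..n}" for a
    using E that by (auto simp: measurement_def psd_mat_def)
  have pG: "psd_mat d2 (G a)" "G a \<in> carrier_mat d2 d2" "G a \<noteq> 0\<^sub>m d2 d2" if "a \<in> {1..m}" for a
    using G that by (auto simp: measurement_def psd_mat_def)
  have dE: "dim_row (E a) = d1" "dim_col (E a) = d1" if "Suc 0 \<le> a" "a \<le> n" for a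
    using pE(2)[of a] that by auto
  have dG: "dim_row (G a) = d2" "dim_col (G a) = d2" if "Suc 0 \<le> a" "a \<le> m" for a
    using pG(2)[of a] that by auto
  have "psd_mat (d1 + d2) (?D a) \<and> ?D a \<noteq> 0\<^sub>m (d1 + d2) (d1 + d2)" if a: "a \<in> {1..n + m}" for a
  proof (cases "a \<le> n")
    case True
    then have "a \<in> {1..n}" using a by auto
    from pE[OF this] True show ?thesis
      by (simp add: direct_sum_family_def psd_mat_direct_sum psd_mat_zero direct_sum_mat_eq_zero_iff)
  next
    case False
    then have "a - n \<in> {1..m}" using a by auto
    from pG[OF this] False show ?thesis
      by (simp add: direct_sum_family_def psd_mat_direct_sum psd_mat_zero direct_sum_mat_eq_zero_iff)
  qed
  moreover have "mat (d1 + d2) (d1 + d2) (\<lambda>(i, j). \<Sum>a\<in>{1..n + m}. ?D a $$ (i, j)) = 1\<^sub>m (d1 + d2)"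
  proof (rule eq_matI)
    fix i j assume "i < dim_row (1\<^sub>m (d1 + d2) :: complex mat)" "j < dim_col (1\<^sub>m (d1 + d2) :: complex mat)"
    then have ij: "i < d1 + d2" "j < d1 + d2" by auto
    have sE: "(\<Sum>a\<in>{1..n}. E a $$ (i, j)) = (if i = j then 1 else 0)" if "i < d1" "j < d1" for i j
    proof -
      have "mat d1 d1 (\<lambda>(i, j). \<Sum>a\<in>{1..n}. E a $$ (i, j)) $$ (i, j) = 1\<^sub>m d1 $$ (i, j)"
        using E by (simp add: measurement_def)
      then show ?thesis using that by simp
    qed
    have sG: "(\<Sum>a\<in>{1..m}. G a $$ (i, j)) = (if i = j then 1 else 0)" if "i < d2" "j < d2" for i j
    proof -
      have "mat d2 d2 (\<lambda>(i, j). \<Sum>a\<in>{1..m}. G a $$ (i, j)) $$ (i, j) = 1\<^sub>m d2 $$ (i, j)"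
        using G by (simp add: measurement_def)
      then show ?thesis using that by simp
    qed
    have "(\<Sum>a\<in>{1..n + m}. ?D a $$ (i, j)) =
        (\<Sum>a\<in>{1..n}. ?D a $$ (i, j)) + (\<Sum>a\<in>{1..m}. ?D (a + n) $$ (i, j))"
      using sum.ub_add_nat[of 1 n "\<lambda>a. ?D a $$ (i, j)" m]
        sum.shift_bounds_cl_nat_ivl[of "\<lambda>a. ?D a $$ (i, j)" 1 n m]
      by (simp add: add.commute)
    also have "(\<Sum>a\<in>{1..n}. ?D a $$ (i, j)) =
        (\<Sum>a\<in>{1..n}. if i < d1 \<and> j < d1 then E a $$ (i, j) else 0)"
      using ij by (intro sum.cong refl) (auto simp: dE direct_sum_family_def direct_sum_mat_def)
    also have "(\<Sum>a\<in>{1..m}. ?D (a + n) $$ (i, j)) =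
        (\<Sum>a\<in>{1..m}. if i < d1 \<or> j < d1 then 0 else G a $$ (i - d1, j - d1))"
      using ij by (intro sum.cong refl) (auto simp: dG direct_sum_family_def direct_sum_mat_def)
    finally have "(\<Sum>a\<in>{1..n + m}. ?D a $$ (i, j)) = (if i = j then 1 else 0)"
      using ij sE[of i j] sG[of "i - d1" "j - d1"]
      by (cases "i < d1"; cases "j < d1") auto
    then show "mat (d1 + d2) (d1 + d2) (\<lambda>(i, j). \<Sum>a\<in>{1..n + m}. ?D a $$ (i, j)) $$ (i, j)
      = 1\<^sub>m (d1 + d2) $$ (i, j)" using ij by simp
  qed auto
  ultimately show ?thesis unfolding measurement_def by blast
qed

end

theory Submission
  imports Defs
begin

text \<open>Commutators respect \<open>A \<mapsto> A \<otimes> 1\<close> and direct sums, so everything reduces to singular values.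
  Triangularising \<open>A\<^sup>*A\<close> by Schur's theorem triangularises \<open>A\<^sup>*A \<otimes> 1\<close> too, with every
  diagonal entry repeated \<open>d\<^sub>2\<close> times; hence every singular value of \<open>A \<otimes> 1\<close> is repeated \<open>d\<^sub>2\<close> times.
  In a direct sum the mixed commutators vanish, while the others are padded by a zero block, which
  only adds vanishing singular values.\<close>

section \<open>Adjoints and basic facts on singular values\<close>

lemma mat_adjoint_dim [simp]:
  "dim_row (mat_adjoint A) = dim_col A" "dim_col (mat_adjoint A) = dim_row A"
  by (simp_all add: mat_adjoint_def)

lemma mat_adjoint_carrier [simp]:
  "A \<in> carrier_mat n m \<Longrightarrow> mat_adjoint A \<in> carrier_mat m n"
  by (intro carrier_matI) auto

lemma mat_adjoint_index [simp]:
  fixes A :: "complex mat"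
  assumes "i < dim_col A" "j < dim_row A"
  shows "mat_adjoint A $$ (i, j) = cnj (A $$ (j, i))"
  using assms by (simp add: mat_adjoint_def mat_of_rows_index)

lemma mat_adjoint_cscalar_prod:
  fixes A :: "complex mat"
  assumes "A \<in> carrier_mat n m" "u \<in> carrier_vec n" "v \<in> carrier_vec m"
  shows "(mat_adjoint A *\<^sub>v u) \<bullet>c v = u \<bullet>c (A *\<^sub>v v)"
proof -
  have "(mat_adjoint A *\<^sub>v u) \<bullet>c v = (\<Sum>i<m. \<Sum>j<n. cnj (A $$ (j, i)) * u $ j * cnj (v $ i))"
    using assms by (auto simp: scalar_prod_def atLeast0LessThan sum_distrib_right intro!: sum.cong)
  also have "\<dots> = (\<Sum>j<n. \<Sum>i<m. cnj (A $$ (j, i)) * u $ j * cnj (v $ i))"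
    by (rule sum.swap)
  also have "\<dots> = u \<bullet>c (A *\<^sub>v v)"
    using assms
    by (auto simp: scalar_prod_def atLeast0LessThan sum_distrib_left mult_ac intro!: sum.cong)
  finally show ?thesis .
qed

text \<open>For an eigenvector \<open>v\<close>, moving the adjoint across the inner product turns
  \<open>x\<close> times the squared norm of \<open>v\<close> into the squared norm of
  \<open>A *\<^sub>v v\<close>.\<close>

lemma eigenvalue_adjoint_mult_nonneg:
  assumes A: "(A :: complex mat) \<in> carrier_mat n m" and "eigenvalue (mat_adjoint A * A) x"
  shows "0 \<le> Re x"
proof -
  have "dim_row (mat_adjoint A * A) = m" using A by auto
  with assms(2) obtain v where v: "v \<in> carrier_vec m" "v \<noteq> 0\<^sub>v m"
    and ev: "(mat_adjoint A * A) *\<^sub>v v = x \<cdot>\<^sub>v v"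
    unfolding eigenvalue_def eigenvector_def by auto
  have "x * (v \<bullet>c v) = (x \<cdot>\<^sub>v v) \<bullet>c v"
    using v by simp
  also have "x \<cdot>\<^sub>v v = mat_adjoint A *\<^sub>v (A *\<^sub>v v)"
    using ev assoc_mult_mat_vec[OF mat_adjoint_carrier[OF A] A v(1)] by simp
  also have "\<dots> \<bullet>c v = (A *\<^sub>v v) \<bullet>c (A *\<^sub>v v)"
    using A v by (intro mat_adjoint_cscalar_prod[OF A]) auto
  also have "\<dots> \<ge> 0" by (rule conjugate_square_ge_0_vec)
  finally have "0 \<le> x * (v \<bullet>c v)" .
  \<comment> \<open>In the order on the complex numbers this makes \<open>v \<bullet>c v\<close> a
    positive real, so the real part of the product above is \<open>Re x\<close> times a positive
    number.\<close>
  moreover have "0 < v \<bullet>c v" using v by simp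
  ultimately show ?thesis
    by (auto simp: less_eq_complex_def less_complex_def zero_le_mult_iff)
qed

lemma char_poly_nonzero:
  assumes "(A :: 'a :: comm_ring_1 mat) \<in> carrier_mat n n"
  shows "char_poly A \<noteq> 0"
  using degree_monic_char_poly[OF assms] by auto

text \<open>The HOL function \<open>sqrt\<close> is odd and takes negative values on negative reals,
  so the sign has to come from the eigenvalues. It is used for \<open>p = \<infinity>\<close>, where
  padding with zeros must not raise the maximum.\<close>

lemma singular_values_nonneg:
  assumes A: "A \<in> carrier_mat n m" and "s \<in># singular_values A"
  shows "0 \<le> s"
proof -
  have c: "mat_adjoint A * A \<in> carrier_mat m m" using A by auto
  from assms(2) obtain x where "poly (char_poly (mat_adjoint A * A)) x = 0" "s = sqrt (Re x)"
    unfolding singular_values_def using char_poly_nonzero[OF c] by auto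
  then show ?thesis
    using eigenvalue_adjoint_mult_nonneg[OF A] eigenvalue_root_char_poly[OF c] by simp
qed

text \<open>A complex polynomial has as many roots, with multiplicity, as its degree. In positive
  dimension this makes the multiset non-empty, so that \<open>Max\<close> is meaningful.\<close>

lemma size_singular_values:
  assumes "A \<in> carrier_mat n m"
  shows "size (singular_values A) = m"
proof -
  have "mat_adjoint A * A \<in> carrier_mat m m" using assms by auto
  from degree_monic_char_poly[OF this] show ?thesis
    by (simp add: singular_values_def size_proots_complex)
qed

lemma singular_values_zero: "singular_values (0\<^sub>m n n) = replicate_mset n 0"
proof -
  have "mat_adjoint (0\<^sub>m n n :: complex mat) * 0\<^sub>m n n = 0\<^sub>m n n"
    by (rule right_mult_zero_mat[of _ n]) simp
  moreover have "char_poly (0\<^sub>m n n :: complex mat) = [:0, 1:] ^ n"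
    by (simp add: char_poly_upper_triangular[of _ n] diag_mat_def o_def
        prod.list_conv_set_nth atLeast0LessThan)
  ultimately show ?thesis
    unfolding singular_values_def by (simp add: proots_power)
qed

section \<open>Algebra of the Kronecker product\<close>

lemma tensor_mat_dim [simp]:
  "dim_row (tensor_mat A B) = dim_row A * dim_row B"
  "dim_col (tensor_mat A B) = dim_col A * dim_col B"
  by (simp_all add: tensor_mat_def)

lemma tensor_mat_carrier:
  "A \<in> carrier_mat m n \<Longrightarrow> B \<in> carrier_mat k l \<Longrightarrow> tensor_mat A B \<in> carrier_mat (m * k) (n * l)"
  by (intro carrier_matI) auto

lemma tensor_mat_index:
  assumes "A \<in> carrier_mat m n" "B \<in> carrier_mat k l" "i < m * k" "j < n * l"
  shows "tensor_mat A B $$ (i, j) = A $$ (i div k, j div l) * B $$ (i mod k, j mod l)"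
  using assms by (simp add: tensor_mat_def)

lemma mult_index_lt:
  fixes i r :: nat
  assumes "i < m" "r < k"
  shows "i * k + r < m * k"
proof -
  have "i * k + r < Suc i * k" using assms by simp
  also have "\<dots> \<le> m * k" using assms by (intro mult_right_mono) auto
  finally show ?thesis .
qed

lemma div_mod_index_lt:
  fixes i :: nat
  assumes "i < m * k"
  shows "i div k < m" "i mod k < k"
  using assms by (auto simp: less_mult_imp_div_less intro!: mod_less_divisor gr0I)

lemma mult_mat_index:
  assumes "A \<in> carrier_mat n m" "B \<in> carrier_mat m l" "i < n" "j < l"
  shows "(A * B) $$ (i, j) = (\<Sum>r<m. A $$ (i, r) * B $$ (r, j))"
  using assms by (simp add: scalar_prod_def atLeast0LessThan)

text \<open>The mixed-product rule. Writing the inner summation index as \<open>a * l + b\<close>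
  separates the two factors, and the double sum becomes a product of two single sums.\<close>

lemma tensor_mat_mult:
  assumes A: "A \<in> carrier_mat m n" and C: "C \<in> carrier_mat n q"
    and B: "B \<in> carrier_mat k l" and D: "D \<in> carrier_mat l r"
  shows "tensor_mat A B * tensor_mat C D = tensor_mat (A * C) (B * D)"
proof (rule eq_matI)
  have AB: "tensor_mat A B \<in> carrier_mat (m * k) (n * l)"
    and CD: "tensor_mat C D \<in> carrier_mat (n * l) (q * r)"
    and AC: "A * C \<in> carrier_mat m q" and BD: "B * D \<in> carrier_mat k r"
    using assms by (auto intro: tensor_mat_carrier)
  fix i j assume "i < dim_row (tensor_mat (A * C) (B * D))" "j < dim_col (tensor_mat (A * C) (B * D))"
  then have i: "i < m * k" and j: "j < q * r" using assms by auto
  note lt = div_mod_index_lt[OF i] div_mod_index_lt[OF j]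
  have "(tensor_mat A B * tensor_mat C D) $$ (i, j) =
      (\<Sum>a<n. \<Sum>b<l. tensor_mat A B $$ (i, a * l + b) * tensor_mat C D $$ (a * l + b, j))"
    by (simp add: mult_mat_index[OF AB CD i j] sum_lessThan_mult)
  also have "\<dots> = (\<Sum>a<n. \<Sum>b<l. (A $$ (i div k, a) * C $$ (a, j div r)) *
      (B $$ (i mod k, b) * D $$ (b, j mod r)))"
    using i j
    by (intro sum.cong refl)
      (simp add: tensor_mat_index[OF A B] tensor_mat_index[OF C D] mult_index_lt)
  also have "\<dots> = (A * C) $$ (i div k, j div r) * (B * D) $$ (i mod k, j mod r)"
    using lt by (simp add: mult_mat_index[OF A C] mult_mat_index[OF B D] sum_product)
  also have "\<dots> = tensor_mat (A * C) (B * D) $$ (i, j)"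
    by (simp add: tensor_mat_index[OF AC BD i j])
  finally show "(tensor_mat A B * tensor_mat C D) $$ (i, j) = tensor_mat (A * C) (B * D) $$ (i, j)" .
qed (use assms in auto)

lemma tensor_mat_one_one: "tensor_mat (1\<^sub>m m) (1\<^sub>m k) = 1\<^sub>m (m * k)"
proof (rule eq_matI)
  fix i j assume "i < dim_row (1\<^sub>m (m * k) :: complex mat)" "j < dim_col (1\<^sub>m (m * k) :: complex mat)"
  then have ij: "i < m * k" "j < m * k" by auto
  have "i = j" if "i div k = j div k" "i mod k = j mod k"
    using that by (metis div_mult_mod_eq)
  then show "tensor_mat (1\<^sub>m m) (1\<^sub>m k) $$ (i, j) = 1\<^sub>m (m * k) $$ (i, j)"
    using ij div_mod_index_lt[OF ij(1)] div_mod_index_lt[OF ij(2)]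
    by (auto simp: tensor_mat_index[of _ m m _ k k])
qed auto

lemma tensor_mat_minus:
  assumes "A \<in> carrier_mat m n" "C \<in> carrier_mat m n" "B \<in> carrier_mat k l"
  shows "tensor_mat (A - C) B = tensor_mat A B - tensor_mat C B"
proof (rule eq_matI)
  fix i j assume "i < dim_row (tensor_mat A B - tensor_mat C B)"
    "j < dim_col (tensor_mat A B - tensor_mat C B)"
  then have ij: "i < m * k" "j < n * l" using assms by auto
  have AC: "A - C \<in> carrier_mat m n" using assms by auto
  show "tensor_mat (A - C) B $$ (i, j) = (tensor_mat A B - tensor_mat C B) $$ (i, j)"
    using ij assms div_mod_index_lt[OF ij(1)] div_mod_index_lt[OF ij(2)]
    by (simp add: tensor_mat_index[OF AC assms(3)] tensor_mat_index[OF assms(1,3)]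
        tensor_mat_index[OF assms(2,3)] left_diff_distrib)
qed (use assms in auto)

lemma mat_adjoint_tensor: "mat_adjoint (tensor_mat A B) = tensor_mat (mat_adjoint A) (mat_adjoint B)"
proof (rule eq_matI)
  fix i j assume "i < dim_row (tensor_mat (mat_adjoint A) (mat_adjoint B))"
    "j < dim_col (tensor_mat (mat_adjoint A) (mat_adjoint B))"
  then have ij: "i < dim_col A * dim_col B" "j < dim_row A * dim_row B" by auto
  then show "mat_adjoint (tensor_mat A B) $$ (i, j) =
      tensor_mat (mat_adjoint A) (mat_adjoint B) $$ (i, j)"
    using div_mod_index_lt[OF ij(1)] div_mod_index_lt[OF ij(2)] by (simp add: tensor_mat_def)
qed auto

lemma mat_adjoint_one: "mat_adjoint (1\<^sub>m n) = (1\<^sub>m n :: complex mat)"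
  by (rule eq_matI) auto

text \<open>The mixed-product rule moves both products inside the first factor, and the Kronecker
  product is additive there.\<close>

lemma commutator_tensor_one:
  assumes "A \<in> carrier_mat n n" "B \<in> carrier_mat n n"
  shows "commutator (tensor_mat A (1\<^sub>m k)) (tensor_mat B (1\<^sub>m k)) = tensor_mat (commutator A B) (1\<^sub>m k)"
proof -
  have c: "A * B \<in> carrier_mat n n" "B * A \<in> carrier_mat n n" using assms by auto
  note m = tensor_mat_mult[OF _ _ one_carrier_mat one_carrier_mat, of _ n n _ n k]
  show ?thesis
    unfolding commutator_def m[OF assms] m[OF assms(2,1)]
    by (simp add: tensor_mat_minus[OF c one_carrier_mat])
qed

section \<open>Spectrum and Schatten norm of the trivial extension\<close>

text \<open>Since the index of \<open>T\<close> is the quotient by \<open>k\<close>, the extension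
  is again upper triangular, and each diagonal entry of \<open>T\<close> occurs \<open>k\<close>
  times in a row.\<close>

lemma char_poly_tensor_one_upper_triangular:
  assumes T: "T \<in> carrier_mat n n" and ut: "upper_triangular T"
  shows "char_poly (tensor_mat T (1\<^sub>m k)) = char_poly T ^ k"
proof -
  have c: "tensor_mat T (1\<^sub>m k) \<in> carrier_mat (n * k) (n * k)"
    using T by (auto intro: tensor_mat_carrier)
  have ix: "tensor_mat T (1\<^sub>m k) $$ (i, j) =
      T $$ (i div k, j div k) * (if i mod k = j mod k then 1 else 0)"
    if "i < n * k" "j < n * k" for i j
    using that div_mod_index_lt[OF that(1)] div_mod_index_lt[OF that(2)]
    by (simp add: tensor_mat_index[OF T one_carrier_mat])
  have "upper_triangular (tensor_mat T (1\<^sub>m k))"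
  proof
    fix i j assume ji: "j < i" and "i < dim_row (tensor_mat T (1\<^sub>m k))"
    then have i: "i < n * k" using T by simp
    \<comment> \<open>If both failed, recombining quotient and remainder would give
      \<open>i \<le> j\<close>. In the first case the entry comes from below the diagonal of
      \<open>T\<close>; in the second the remainders differ and the identity factor
      vanishes.\<close>
    have "j div k < i div k \<or> j mod k < i mod k"
    proof (rule ccontr)
      assume "\<not> ?thesis"
      then have "i div k * k + i mod k \<le> j div k * k + j mod k"
        by (intro add_mono mult_right_mono) auto
      with ji show False by simp
    qed
    moreover have "j div k \<le> i div k" using ji by (intro div_le_mono) auto
    ultimately have "j div k < i div k \<or> i mod k \<noteq> j mod k" by auto
    then show "tensor_mat T (1\<^sub>m k) $$ (i, j) = 0"
      using ut T i ji div_mod_index_lt[OF i] by (auto simp: ix)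
  qed
  then have "char_poly (tensor_mat T (1\<^sub>m k)) = (\<Prod>i<n * k. [:- (tensor_mat T (1\<^sub>m k) $$ (i, i)), 1:])"
    using T by (simp add: char_poly_upper_triangular[OF c] diag_mat_def o_def
        prod.list_conv_set_nth atLeast0LessThan)
  also have "\<dots> = (\<Prod>i<n * k. [:- T $$ (i div k, i div k), 1:])"
    by (intro prod.cong refl) (simp add: ix)
  \<comment> \<open>The indices are cut into \<open>n\<close> consecutive blocks of length
    \<open>k\<close>. The quotient is constant on a block, so each block contributes a
    \<open>k\<close>-th power.\<close>
  also have "\<dots> = (\<Prod>i<n. \<Prod>l\<in>{i * k..<i * k + k}. [:- T $$ (l div k, l div k), 1:])"
    by (rule prod.nat_group[symmetric])
  also have "\<dots> = (\<Prod>i<n. \<Prod>l\<in>{i * k..<i * k + k}. [:- T $$ (i, i), 1:])"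
  proof (intro prod.cong refl)
    fix i l assume "l \<in> {i * k..<i * k + k}"
    then have "l div k = i"
      by (auto intro!: div_nat_eqI simp: algebra_simps)
    then show "[:- T $$ (l div k, l div k), 1:] = [:- T $$ (i, i), 1:]" by simp
  qed
  also have "\<dots> = char_poly T ^ k"
    using T by (simp add: char_poly_upper_triangular[OF T ut] diag_mat_def o_def
        prod.list_conv_set_nth atLeast0LessThan prod_power_distrib)
  finally show ?thesis .
qed

text \<open>A similarity of \<open>A\<close> with a triangular \<open>T\<close> through
  \<open>P\<close> and \<open>Q\<close> extends to one through
  \<open>tensor_mat P (1\<^sub>m k)\<close> and \<open>tensor_mat Q (1\<^sub>m k)\<close> by the
  mixed-product rule, and similarity preserves the characteristic polynomial.\<close>

lemma char_poly_tensor_one: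
  assumes A: "A \<in> carrier_mat n n"
  shows "char_poly (tensor_mat A (1\<^sub>m k)) = char_poly A ^ k"
proof -
  \<comment> \<open>Schur's theorem asks for a splitting into linear factors, available over the
    complex numbers.\<close>
  obtain as where "char_poly A = (\<Prod>a\<leftarrow>as. [:- a, 1:])"
    using char_poly_factorized[OF A] by blast
  from schur_decomposition_exists[OF A this] obtain T
    where T: "T \<in> carrier_mat n n" "upper_triangular T" and sim: "similar_mat A T" by blast
  then obtain P Q where "similar_mat_wit A T P Q" unfolding similar_mat_def by blast
  note w = similar_mat_witD2[OF A this]
  note m = tensor_mat_mult[OF _ _ one_carrier_mat one_carrier_mat, of _ n n _ n k]
  have PT: "P * T \<in> carrier_mat n n" using w T by auto
  have "similar_mat (tensor_mat A (1\<^sub>m k)) (tensor_mat T (1\<^sub>m k))"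
  proof (rule similar_matI)
    show "{tensor_mat A (1\<^sub>m k), tensor_mat T (1\<^sub>m k), tensor_mat P (1\<^sub>m k), tensor_mat Q (1\<^sub>m k)}
        \<subseteq> carrier_mat (n * k) (n * k)"
      using w A T by (auto intro: tensor_mat_carrier)
    show "tensor_mat P (1\<^sub>m k) * tensor_mat Q (1\<^sub>m k) = 1\<^sub>m (n * k)"
      using w by (simp add: m tensor_mat_one_one)
    show "tensor_mat Q (1\<^sub>m k) * tensor_mat P (1\<^sub>m k) = 1\<^sub>m (n * k)"
      using w by (simp add: m tensor_mat_one_one)
    show "tensor_mat A (1\<^sub>m k) = tensor_mat P (1\<^sub>m k) * tensor_mat T (1\<^sub>m k) * tensor_mat Q (1\<^sub>m k)"
      using w(3) by (simp add: m[OF w(6) T(1)] m[OF PT w(7)])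
  qed
  from char_poly_similar[OF this] char_poly_similar[OF sim] show ?thesis
    by (simp add: char_poly_tensor_one_upper_triangular[OF T])
qed

lemma image_mset_repeat_mset: "image_mset f (repeat_mset k M) = repeat_mset k (image_mset f M)"
  by (induction k) auto

text \<open>The Gram matrix of the extension is the extension of the Gram matrix, and a
  \<open>k\<close>-th power repeats every root \<open>k\<close> times.\<close>

lemma singular_values_tensor_one:
  assumes A: "A \<in> carrier_mat n n"
  shows "singular_values (tensor_mat A (1\<^sub>m k)) = repeat_mset k (singular_values A)"
proof -
  have c: "mat_adjoint A * A \<in> carrier_mat n n" using A by auto
  have "mat_adjoint (tensor_mat A (1\<^sub>m k)) * tensor_mat A (1\<^sub>m k) =
      tensor_mat (mat_adjoint A * A) (1\<^sub>m k)"
    unfolding mat_adjoint_tensor mat_adjoint_one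
    by (simp add: tensor_mat_mult[OF mat_adjoint_carrier[OF A] A one_carrier_mat one_carrier_mat])
  then show ?thesis
    by (simp add: singular_values_def char_poly_tensor_one[OF c] proots_power image_mset_repeat_mset)
qed

lemma set_mset_repeat_mset:
  assumes "0 < k"
  shows "set_mset (repeat_mset k M) = set_mset M"
  using assms by (auto simp flip: count_greater_zero_iff)

text \<open>For \<open>p = \<infinity>\<close> only the set of singular values counts, and
  repetition preserves it because \<open>0 < k\<close>. Otherwise the sum of powers is multiplied by
  \<open>k\<close>, and the outer power distributes over this product of non-negative
  numbers.\<close>

lemma schatten_norm_tensor_one:
  assumes A: "A \<in> carrier_mat n n" and "0 < k"
  shows "schatten_norm p (tensor_mat A (1\<^sub>m k)) =
    (if p = \<infinity> then 1 else real k powr (1 / real_of_ereal p)) * schatten_norm p A"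
proof (cases "p = \<infinity>")
  case True
  then show ?thesis
    using \<open>0 < k\<close>
    by (simp add: schatten_norm_def singular_values_tensor_one[OF A] set_mset_repeat_mset)
next
  case False
  have sum: "sum_mset (repeat_mset k M) = real k * sum_mset M" for M
    by (induction k) (auto simp: algebra_simps)
  have nonneg: "0 \<le> (\<Sum>s\<in>#M. s powr real_of_ereal p)" for M
    by (induction M) auto
  show ?thesis
    unfolding schatten_norm_def singular_values_tensor_one[OF A] image_mset_repeat_mset sum
    using False nonneg by (simp only: powr_mult of_nat_0_le_iff if_False simp_thms)
qed

section \<open>Direct sums and padding by zero blocks\<close>

lemma direct_sum_mat_mult:
  assumes A: "A \<in> carrier_mat m n" and C: "C \<in> carrier_mat n q"
    and B: "B \<in> carrier_mat k l" and D: "D \<in> carrier_mat l r"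
  shows "direct_sum_mat A B * direct_sum_mat C D = direct_sum_mat (A * C) (B * D)"
  unfolding direct_sum_mat_def using assms
  by (subst mult_four_block_mat[of _ m n _ l _ k _ _ q _ r]) auto

lemma direct_sum_mat_minus:
  assumes "A \<in> carrier_mat m n" "C \<in> carrier_mat m n" "B \<in> carrier_mat k l" "D \<in> carrier_mat k l"
  shows "direct_sum_mat A B - direct_sum_mat C D = direct_sum_mat (A - C) (B - D)"
  using assms by (intro eq_matI) (auto simp: direct_sum_mat_def)

lemma mat_adjoint_direct_sum:
  "mat_adjoint (direct_sum_mat A B) = direct_sum_mat (mat_adjoint A) (mat_adjoint B)"
  by (rule eq_matI) (auto simp: direct_sum_mat_def)

lemma commutator_direct_sum:
  assumes "A \<in> carrier_mat m m" "C \<in> carrier_mat m m" "B \<in> carrier_mat k k" "D \<in> carrier_mat k k"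
  shows "commutator (direct_sum_mat A B) (direct_sum_mat C D) =
    direct_sum_mat (commutator A C) (commutator B D)"
proof -
  have "A * C \<in> carrier_mat m m" "C * A \<in> carrier_mat m m"
    "B * D \<in> carrier_mat k k" "D * B \<in> carrier_mat k k"
    using assms by auto
  then show ?thesis
    unfolding commutator_def
    by (simp add: direct_sum_mat_mult[OF assms] direct_sum_mat_mult[OF assms(2,1,4,3)]
        direct_sum_mat_minus)
qed

lemma commutator_carrier [simp]:
  "A \<in> carrier_mat n n \<Longrightarrow> B \<in> carrier_mat n n \<Longrightarrow> commutator A B \<in> carrier_mat n n"
  unfolding commutator_def by (metis minus_carrier_mat mult_carrier_mat)

lemma commutator_zero:
  assumes "A \<in> carrier_mat n n"
  shows "commutator A (0\<^sub>m n n) = 0\<^sub>m n n" "commutator (0\<^sub>m n n) A = 0\<^sub>m n n"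
  using assms by (simp_all add: commutator_def)

text \<open>The Gram matrix is block diagonal, so its characteristic polynomial is a product of
  non-zero polynomials, whose root multisets add.\<close>

lemma singular_values_direct_sum:
  assumes A: "A \<in> carrier_mat m m" and B: "B \<in> carrier_mat k k"
  shows "singular_values (direct_sum_mat A B) = singular_values A + singular_values B"
proof -
  let ?A = "mat_adjoint A * A" and ?B = "mat_adjoint B * B"
  have c: "?A \<in> carrier_mat m m" "?B \<in> carrier_mat k k" using assms by auto
  have "char_poly (direct_sum_mat ?A ?B) = char_poly ?A * char_poly ?B"
  \<comment> \<open>The block rule also asks that both characteristic polynomials split into linear
    factors, which holds over the complex numbers.\<close>
  proof (rule char_poly_0_block[OF _ _ _ c(1) zero_carrier_mat c(2)])
    show "direct_sum_mat ?A ?B = four_block_mat ?A (0\<^sub>m m k) (0\<^sub>m k m) ?B"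
      using A B by (simp add: direct_sum_mat_def)
  qed (use char_poly_factorized[OF c(1)] char_poly_factorized[OF c(2)] in blast)+
  moreover have "mat_adjoint (direct_sum_mat A B) * direct_sum_mat A B = direct_sum_mat ?A ?B"
    by (simp add: mat_adjoint_direct_sum
        direct_sum_mat_mult[OF mat_adjoint_carrier[OF A] A mat_adjoint_carrier[OF B] B])
  ultimately show ?thesis
    using char_poly_nonzero[OF c(1)] char_poly_nonzero[OF c(2)]
    by (simp add: singular_values_def proots_mult)
qed

text \<open>In the sum of powers the extra zeros contribute \<open>0 powr _ = 0\<close>. For
  \<open>p = \<infinity>\<close> the old maximum is over a non-empty set of non-negative numbers, by
  \<open>0 < n\<close>, so inserting zero leaves it unchanged.\<close>

lemma schatten_norm_padded_singular_values:
  assumes A: "A \<in> carrier_mat n n" and "0 < n"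
    and sv: "singular_values B = singular_values A + replicate_mset k 0"
  shows "schatten_norm p B = schatten_norm p A"
proof (cases "p = \<infinity>")
  case True
  let ?S = "set_mset (singular_values A)"
  have ne: "?S \<noteq> {}"
    using size_singular_values[OF A] \<open>0 < n\<close> by auto
  then obtain s where "s \<in> ?S" by blast
  then have "0 \<le> Max ?S"
    using singular_values_nonneg[OF A] by (intro order_trans[OF _ Max_ge[of _ s]]) auto
  then have "Max (insert 0 ?S) = Max ?S"
    using ne by simp
  then show ?thesis
    using True by (simp add: schatten_norm_def sv)
next
  case False
  then show ?thesis by (simp add: schatten_norm_def sv)
qed

lemma schatten_norm_direct_sum_zero:
  assumes "A \<in> carrier_mat n n" "0 < n"
  shows "schatten_norm p (direct_sum_mat A (0\<^sub>m k k)) = schatten_norm p A"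
    "schatten_norm p (direct_sum_mat (0\<^sub>m k k) A) = schatten_norm p A"
  using assms
  by (auto intro!: schatten_norm_padded_singular_values[of _ n _ k]
      simp: singular_values_direct_sum[of _ n _ k] singular_values_direct_sum[of _ k _ n]
        singular_values_zero)

lemma schatten_norm_zero:
  assumes "0 < n"
  shows "schatten_norm p (0\<^sub>m n n) = 0"
  using assms by (simp add: schatten_norm_def singular_values_zero)

section \<open>Summation over the outcomes\<close>

lemma measurement_carrier:
  assumes "measurement d n E" "a \<in> {1..n}"
  shows "E a \<in> carrier_mat d d"
  using assms by (auto simp: measurement_def psd_mat_def)

lemma Upsilon_tensor_one:
  assumes "0 < k" "measurement d nE E" "measurement d nF F"
  shows "Upsilon p nE (\<lambda>a. tensor_mat (E a) (1\<^sub>m k)) nF (\<lambda>b. tensor_mat (F b) (1\<^sub>m k)) =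
    (if p = \<infinity> then 1 else real k powr (1 / real_of_ereal p)) * Upsilon p nE E nF F"
  unfolding Upsilon_def sum_distrib_left
proof (intro sum.cong refl)
  fix a b assume "a \<in> {1..nE}" "b \<in> {1..nF}"
  then have c: "E a \<in> carrier_mat d d" "F b \<in> carrier_mat d d"
    using assms measurement_carrier by blast+
  show "schatten_norm p (commutator (tensor_mat (E a) (1\<^sub>m k)) (tensor_mat (F b) (1\<^sub>m k))) =
      (if p = \<infinity> then 1 else real k powr (1 / real_of_ereal p)) *
      schatten_norm p (commutator (E a) (F b))"
    unfolding commutator_tensor_one[OF c]
    using c assms by (intro schatten_norm_tensor_one[where n = d]) auto
qed

text \<open>Cutting the outcome ranges at \<open>nE\<close> and \<open>nF\<close> gives four double
  sums. The two unmixed ones are the summands on the right, up to zero padding; the two mixed ones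
  vanish.\<close>

lemma Upsilon_direct_sum:
  assumes d: "0 < d1" "0 < d2"
    and M: "measurement d1 nE E" "measurement d1 nF F" "measurement d2 mE G" "measurement d2 mF H"
  shows "Upsilon p (nE + mE) (direct_sum_family d1 d2 nE E G) (nF + mF) (direct_sum_family d1 d2 nF F H)
    = Upsilon p nE E nF F + Upsilon p mE G mF H"
proof -
  let ?E = "direct_sum_family d1 d2 nE E G" and ?F = "direct_sum_family d1 d2 nF F H"
  let ?N = "\<lambda>a b. schatten_norm p (commutator (?E a) (?F b))"
  \<comment> \<open>Outcomes beyond \<open>n\<close> are renumbered from \<open>1\<close>, which
    cancels the shift \<open>a - n\<close> in \<open>direct_sum_family\<close>.\<close>
  have split: "(\<Sum>a\<in>{1..n + m}. f a) = (\<Sum>a\<in>{1..n}. f a) + (\<Sum>a\<in>{1..m}. f (a + n))"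
    for f :: "nat \<Rightarrow> real" and n m
    using sum.ub_add_nat[of 1 n f m] sum.shift_bounds_cl_nat_ivl[of f 1 n m]
    by (simp add: add.commute)
  have c: "\<And>a. a \<in> {1..nE} \<Longrightarrow> E a \<in> carrier_mat d1 d1"
      "\<And>b. b \<in> {1..nF} \<Longrightarrow> F b \<in> carrier_mat d1 d1"
      "\<And>a. a \<in> {1..mE} \<Longrightarrow> G a \<in> carrier_mat d2 d2"
      "\<And>b. b \<in> {1..mF} \<Longrightarrow> H b \<in> carrier_mat d2 d2"
    using M measurement_carrier by blast+
  note comm = commutator_direct_sum[of _ d1 _ _ d2] commutator_zero
  have z: "direct_sum_mat (0\<^sub>m d1 d1) (0\<^sub>m d2 d2) = 0\<^sub>m (d1 + d2) (d1 + d2)"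
    by (simp add: direct_sum_mat_eq_zero_iff)
  have EF: "?N a b = schatten_norm p (commutator (E a) (F b))" if "a \<in> {1..nE}" "b \<in> {1..nF}" for a b
    using that c(1)[OF that(1)] c(2)[OF that(2)] d
    by (simp add: direct_sum_family_def comm schatten_norm_direct_sum_zero[of _ d1])
  \<comment> \<open>In each block one of the two factors is zero, so both block commutators vanish
    and \<open>z\<close> reduces the norm to that of a zero matrix. The same holds for
    \<open>GF\<close> with the roles exchanged.\<close>
  have EH: "?N a (b + nF) = 0" if "a \<in> {1..nE}" "b \<in> {1..mF}" for a b
    using that c(1)[OF that(1)] c(4)[OF that(2)] d
    by (simp add: direct_sum_family_def comm z schatten_norm_zero)
  have GF: "?N (a + nE) b = 0" if "a \<in> {1..mE}" "b \<in> {1..nF}" for a b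
    using that c(3)[OF that(1)] c(2)[OF that(2)] d
    by (simp add: direct_sum_family_def comm z schatten_norm_zero)
  have GH: "?N (a + nE) (b + nF) = schatten_norm p (commutator (G a) (H b))"
    if "a \<in> {1..mE}" "b \<in> {1..mF}" for a b
    using that c(3)[OF that(1)] c(4)[OF that(2)] d
    by (simp add: direct_sum_family_def comm schatten_norm_direct_sum_zero[of _ d2])
  show ?thesis
    unfolding Upsilon_def split by (simp add: EF EH GF GH sum.distrib cong: sum.cong_simp)
qed

theorem mainTheorem4:
  fixes p :: ereal and d1 d2 nE nF :: nat and E F :: "nat \<Rightarrow> complex mat"
  assumes "1 \<le> p"
    and "1 \<le> d1" and "1 \<le> d2"
    and "measurement d1 nE E" and "measurement d1 nF F"
  shows "Upsilon p nE (\<lambda>a. tensor_mat (E a) (1\<^sub>m d2)) nF (\<lambda>b. tensor_mat (F b) (1\<^sub>m d2)) =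
           (if p = \<infinity> then 1 else real d2 powr (1 / real_of_ereal p)) * Upsilon p nE E nF F
       \<and> (\<forall>(nE2 :: nat) (nF2 :: nat) (E2 :: nat \<Rightarrow> complex mat) (F2 :: nat \<Rightarrow> complex mat).
            measurement d2 nE2 E2 \<longrightarrow> measurement d2 nF2 F2 \<longrightarrow>
            Upsilon p (nE + nE2) (direct_sum_family d1 d2 nE E E2)
                      (nF + nF2) (direct_sum_family d1 d2 nF F F2) =
              Upsilon p nE E nF F + Upsilon p nE2 E2 nF2 F2)"
  using assms
  by (intro conjI allI impI Upsilon_tensor_one[where d = d1] Upsilon_direct_sum) auto

end
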